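(* Let $n,m\ge1$, let $B_0,B_1,\dots,B_m$ be $n\times n$ unitary matrices, let $\alpha_1,\dots,\alpha_m$ be complex numbers with $|\alpha_1|<|\alpha_2|<\cdots<|\alpha_m|$, and let $$T(\lambda)=-B_0+I\lambda+\frac{B_1}{\lambda-\alpha_1}+\cdots+\frac{B_m}{\lambda-\alpha_m}.$$ Then the upper bound $\frac12\left(1+|\alpha_m|+\sqrt{(|\alpha_m|-1)^2+4m}\right)$ for the moduli of the eigenvalues of $T(\lambda)$ is at least as good as the upper bound $\left\{\frac{(2m+1)+(4m+1)^{1/2}}{2}\right\}^{1/2}+|\alpha_m|$, that is, $$\frac12\left(1+|\alpha_m|+\sqrt{(|\alpha_m|-1)^2+4m}\right)\le\left\{\frac{(2m+1)+(4m+1)^{1/2}}{2}\right\}^{1/2}+|\alpha_m|.$$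
   Context: $I$ denotes the $n\times n$ identity matrix. A complex number $\lambda_0$ is an eigenvalue of the rational matrix $T(\lambda)$ if $T(\lambda_0)$ has finite entries and there is a nonzero $v\in\mathbb{C}^n$ with $T(\lambda_0)v=0$. Both quantities compared are upper bounds for $|\lambda_0|$ for every eigenvalue $\lambda_0$ of $T(\lambda)$; the claim to be proved is the displayed inequality between them. *)

theory Defs
  imports "HOL-Complex_Analysis.Complex_Analysis"
begin

definition conj_transpose :: "complex ^ 'n ^ 'm \<Rightarrow> complex ^ 'm ^ 'n" where
  "conj_transpose A = (\<chi> i j. cnj (A $ j $ i))"

definition unitary_matrix :: "complex ^ 'n ^ 'n \<Rightarrow> bool" where
  "unitary_matrix A \<longleftrightarrow>
     conj_transpose A ** A = mat 1 \<and> A ** conj_transpose A = mat 1"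

(* Here mat z is z times the identity matrix.  At z = \<alpha> i division by zero gives a junk
   value; is_eigenvalue_of below excludes the poles. *)
definition rational_matrix ::
  "nat \<Rightarrow> (nat \<Rightarrow> complex ^ 'n ^ 'n) \<Rightarrow> (nat \<Rightarrow> complex) \<Rightarrow> complex \<Rightarrow> complex ^ 'n ^ 'n" where
  "rational_matrix m B \<alpha> z =
     - B 0 + mat z + (\<Sum>i=1..m. (\<chi> r c. B i $ r $ c / (z - \<alpha> i)))"

(* For a matrix of rational functions, "T(z0) has finite entries" means that no entry has a
   pole at z0. *)
definition is_eigenvalue_of :: "(complex \<Rightarrow> complex ^ 'n ^ 'n) \<Rightarrow> complex \<Rightarrow> bool" where
  "is_eigenvalue_of T z0 \<longleftrightarrow>
     (\<forall>r c. \<not> is_pole (\<lambda>z. T z $ r $ c) z0) \<and> (\<exists>v. v \<noteq> 0 \<and> T z0 *v v = 0)"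

definition eigenvalue_modulus_bound :: "(complex \<Rightarrow> complex ^ 'n ^ 'n) \<Rightarrow> real \<Rightarrow> bool" where
  "eigenvalue_modulus_bound T b \<longleftrightarrow> (\<forall>z. is_eigenvalue_of T z \<longrightarrow> cmod z \<le> b)"

end

theory Submission
  imports Defs
begin

text \<open>
  Put \<open>a = \<bar>\<alpha> m\<bar>\<close>. A unitary matrix preserves the Euclidean norm, so if \<open>z\<close> is an eigenvalue with
  eigenvector \<open>v\<close> and \<open>\<bar>z\<bar> > a\<close>, then taking norms in
  \<open>z v = B\<^sub>0 v - \<Sum>\<^sub>i B\<^sub>i v / (z - \<alpha>\<^sub>i)\<close> and using \<open>\<bar>z - \<alpha>\<^sub>i\<bar> \<ge> \<bar>z\<bar> - a\<close> gives
  \<open>\<bar>z\<bar> \<le> 1 + m / (\<bar>z\<bar> - a)\<close>, that is \<open>(\<bar>z\<bar> - 1) (\<bar>z\<bar> - a) \<le> m\<close>. Hence \<open>\<bar>z\<bar>\<close> is at most the larger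
  root of \<open>(x - 1) (x - a) = m\<close>, which is the first bound. That root is at least \<open>a\<close>, so the
  points with \<open>\<bar>z\<bar> \<le> a\<close>, among them all poles, satisfy the bound trivially.

  For the comparison write \<open>s = sqrt (4 m + 1)\<close>. The nested radical is a perfect square,
  \<open>(2 m + 1 + s) / 2 = ((1 + s) / 2)\<^sup>2\<close>, so the second bound is \<open>(1 + s) / 2 + a\<close>, and the
  inequality reduces to \<open>(a - 1)\<^sup>2 + 4 m \<le> (s + a)\<^sup>2 = 4 m + 1 + 2 s a + a\<^sup>2\<close>. The second bound is
  valid because it is no smaller than the first.
\<close>

lemma sum_mult_cnj_eq_norm_power2:
  fixes x :: "complex ^ 'n"
  shows "(\<Sum>i\<in>UNIV. x $ i * cnj (x $ i)) = of_real ((norm x)\<^sup>2)"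
  by (simp add: norm_vec_def L2_set_def sum_nonneg complex_norm_square del: of_real_power)

lemma sum_mult_cnj_adjoint:
  fixes A :: "complex ^ 'n ^ 'm"
  shows "(\<Sum>i\<in>UNIV. (A *v x) $ i * cnj (y $ i))
       = (\<Sum>j\<in>UNIV. x $ j * cnj ((conj_transpose A *v y) $ j))"
proof -
  have "(\<Sum>i\<in>UNIV. (A *v x) $ i * cnj (y $ i))
      = (\<Sum>i\<in>UNIV. \<Sum>j\<in>UNIV. A $ i $ j * x $ j * cnj (y $ i))"
    by (simp add: matrix_vector_mult_def sum_distrib_right)
  also have "\<dots> = (\<Sum>j\<in>UNIV. \<Sum>i\<in>UNIV. A $ i $ j * x $ j * cnj (y $ i))"
    by (rule sum.swap)
  also have "\<dots> = (\<Sum>j\<in>UNIV. x $ j * cnj ((conj_transpose A *v y) $ j))"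
    by (simp add: matrix_vector_mult_def conj_transpose_def sum_distrib_left mult_ac)
  finally show ?thesis .
qed

text \<open>Moving \<open>A\<close> across the Hermitian inner product of \<open>A x\<close> with itself leaves the adjoint of \<open>A\<close>
  applied to \<open>A x\<close>, which is \<open>x\<close>.\<close>
lemma norm_unitary_matrix_mult:
  fixes A :: "complex ^ 'n ^ 'n"
  assumes "unitary_matrix A"
  shows "norm (A *v x) = norm x"
proof -
  have "conj_transpose A *v (A *v x) = x"
    using assms by (simp add: unitary_matrix_def matrix_vector_mul_assoc)
  then have "complex_of_real ((norm (A *v x))\<^sup>2) = of_real ((norm x)\<^sup>2)"
    using sum_mult_cnj_adjoint[of A x "A *v x"]
    by (simp only: sum_mult_cnj_eq_norm_power2)
  then have "(norm (A *v x))\<^sup>2 = (norm x)\<^sup>2"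
    by (simp only: of_real_eq_iff)
  then show ?thesis
    by simp
qed

lemma norm_vector_smult:
  fixes x :: "'a::real_normed_div_algebra ^ 'n"
  shows "norm (c *s x) = norm c * norm x"
  by (simp add: norm_vec_def norm_mult L2_set_right_distrib)

lemma sum_matrix_vector_mult:
  fixes A :: "'i \<Rightarrow> 'a::comm_semiring_1 ^ 'n ^ 'm"
  shows "(\<Sum>i\<in>I. A i) *v x = (\<Sum>i\<in>I. A i *v x)"
  by (induction I rule: infinite_finite_induct) (simp_all add: matrix_vector_mult_add_rdistrib)

lemma mat_vector_mult:
  fixes x :: "'a::comm_semiring_1 ^ 'n"
  shows "mat c *v x = c *s x"
  by (simp add: matrix_vector_mult_def mat_def vec_eq_iff if_distrib if_distribR cong: if_cong)

lemma rational_matrix_vector_mult: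
  "rational_matrix m B \<alpha> z *v v
     = - (B 0 *v v) + z *s v + (\<Sum>i=1..m. (1 / (z - \<alpha> i)) *s (B i *v v))"
proof -
  have "(\<chi> r c. B i $ r $ c / (z - \<alpha> i)) *v v = (1 / (z - \<alpha> i)) *s (B i *v v)" for i
    by (simp add: matrix_vector_mult_def vec_eq_iff sum_divide_distrib)
  moreover have "(- B 0) *v v = - (B 0 *v v)"
    by (simp add: matrix_vector_mult_def vec_eq_iff sum_negf)
  ultimately show ?thesis
    by (simp only: rational_matrix_def matrix_vector_mult_add_rdistrib
        sum_matrix_vector_mult mat_vector_mult)
qed

lemma eigenvalue_outside_poles_inequality:
  fixes B :: "nat \<Rightarrow> complex ^ 'n ^ 'n"
  assumes unitary: "\<And>i. i \<le> m \<Longrightarrow> unitary_matrix (B i)"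
    and poles: "\<And>i. 1 \<le> i \<Longrightarrow> i \<le> m \<Longrightarrow> cmod (\<alpha> i) \<le> a"
    and z: "a < cmod z"
    and v: "v \<noteq> 0" "rational_matrix m B \<alpha> z *v v = 0"
  shows "(cmod z - 1) * (cmod z - a) \<le> real m"
proof -
  have "z *s v = B 0 *v v - (\<Sum>i=1..m. (1 / (z - \<alpha> i)) *s (B i *v v))"
    using v(2) by (simp add: rational_matrix_vector_mult algebra_simps add_eq_0_iff)
  then have "cmod z * norm v
      \<le> norm (B 0 *v v) + norm (\<Sum>i=1..m. (1 / (z - \<alpha> i)) *s (B i *v v))"
    using norm_triangle_ineq4[of "B 0 *v v" "\<Sum>i=1..m. (1 / (z - \<alpha> i)) *s (B i *v v)"]
    by (simp only: flip: norm_vector_smult)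
  also have "norm (\<Sum>i=1..m. (1 / (z - \<alpha> i)) *s (B i *v v))
      \<le> (\<Sum>i=1..m. norm v / (cmod z - a))"
  proof (rule sum_norm_le)
    fix i assume i: "i \<in> {1..m}"
    have "cmod z - a \<le> cmod (z - \<alpha> i)"
      using poles[of i] i norm_triangle_ineq2[of z "\<alpha> i"] by simp
    then show "norm ((1 / (z - \<alpha> i)) *s (B i *v v)) \<le> norm v / (cmod z - a)"
      using i z by (simp add: norm_vector_smult norm_unitary_matrix_mult unitary norm_divide
          frac_le)
  qed
  finally have "cmod z * norm v \<le> (1 + real m / (cmod z - a)) * norm v"
    by (simp add: norm_unitary_matrix_mult unitary algebra_simps)
  then have "cmod z \<le> 1 + real m / (cmod z - a)"
    using v(1) by simp
  then show ?thesis
    using z by (simp add: field_simps)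
qed

text \<open>The bound is the larger root of \<open>(y - 1) * (y - a) = c\<close>: completing the square turns the
  hypothesis into \<open>(2 * x - 1 - a)\<^sup>2 \<le> (a - 1)\<^sup>2 + 4 * c\<close>.\<close>
lemma le_larger_root:
  fixes x a c :: real
  assumes "(x - 1) * (x - a) \<le> c"
  shows "x \<le> 1 / 2 * (1 + a + sqrt ((a - 1)\<^sup>2 + 4 * c))"
proof -
  have "(2 * x - 1 - a)\<^sup>2 \<le> (a - 1)\<^sup>2 + 4 * c"
    using assms by (simp add: power2_eq_square algebra_simps)
  then have "2 * x - 1 - a \<le> sqrt ((a - 1)\<^sup>2 + 4 * c)"
    by (rule real_le_rsqrt)
  then show ?thesis
    by simp
qed

lemma sqrt_denest:
  fixes c :: real
  assumes "0 \<le> c"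
  shows "sqrt (((2 * c + 1) + sqrt (4 * c + 1)) / 2) = (1 + sqrt (4 * c + 1)) / 2"
proof (rule real_sqrt_unique)
  have "(sqrt (4 * c + 1))\<^sup>2 = 4 * c + 1"
    using assms by simp
  then show "((1 + sqrt (4 * c + 1)) / 2)\<^sup>2 = ((2 * c + 1) + sqrt (4 * c + 1)) / 2"
    by (simp add: power2_eq_square field_simps)
qed (use assms in simp)

lemma larger_root_le_nested_radical_bound:
  fixes a c :: real
  assumes "0 \<le> a" "0 \<le> c"
  shows "1 / 2 * (1 + a + sqrt ((a - 1)\<^sup>2 + 4 * c))
           \<le> sqrt (((2 * c + 1) + sqrt (4 * c + 1)) / 2) + a"
proof -
  define s where "s = sqrt (4 * c + 1)"
  have s: "s\<^sup>2 = 4 * c + 1" "0 \<le> s"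
    using assms by (simp_all add: s_def)
  have "0 \<le> s * a"
    using s assms by simp
  moreover have "(s + a)\<^sup>2 = (a - 1)\<^sup>2 + 4 * c + 2 * (s * a) + 2 * a"
    using s(1) by (simp add: power2_sum power2_diff)
  ultimately have "(a - 1)\<^sup>2 + 4 * c \<le> (s + a)\<^sup>2"
    using assms(1) by linarith
  then have "sqrt ((a - 1)\<^sup>2 + 4 * c) \<le> s + a"
    using s(2) assms by (intro real_le_lsqrt) auto
  then show ?thesis
    unfolding sqrt_denest[OF assms(2)] by (fold s_def) argo
qed

theorem theorem3p2:
  fixes m :: nat
    and B :: "nat \<Rightarrow> complex ^ 'n ^ 'n"
    and \<alpha> :: "nat \<Rightarrow> complex"
  assumes "m \<ge> 1"
    and "\<And>i. i \<le> m \<Longrightarrow> unitary_matrix (B i)"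
    and "\<And>i j. 1 \<le> i \<Longrightarrow> i < j \<Longrightarrow> j \<le> m \<Longrightarrow> cmod (\<alpha> i) < cmod (\<alpha> j)"
  shows "eigenvalue_modulus_bound (rational_matrix m B \<alpha>)
           (1 / 2 * (1 + cmod (\<alpha> m) + sqrt ((cmod (\<alpha> m) - 1)^2 + 4 * real m)))
       \<and> eigenvalue_modulus_bound (rational_matrix m B \<alpha>)
           (sqrt (((2 * real m + 1) + sqrt (4 * real m + 1)) / 2) + cmod (\<alpha> m))
       \<and> 1 / 2 * (1 + cmod (\<alpha> m) + sqrt ((cmod (\<alpha> m) - 1)^2 + 4 * real m))
           \<le> sqrt (((2 * real m + 1) + sqrt (4 * real m + 1)) / 2) + cmod (\<alpha> m)"
    (is "eigenvalue_modulus_bound ?T ?b1 \<and> eigenvalue_modulus_bound ?T ?b2 \<and> _")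
proof -
  have poles: "cmod (\<alpha> i) \<le> cmod (\<alpha> m)" if "1 \<le> i" "i \<le> m" for i
    using assms(3)[of i m] that by (cases "i = m") auto
  have "cmod z \<le> ?b1" if "is_eigenvalue_of ?T z" for z
  proof (cases "cmod z \<le> cmod (\<alpha> m)")
    case True
    \<comment> \<open>The product \<open>(x - 1) * (x - a)\<close> vanishes at \<open>x = a\<close>, so \<open>a\<close> lies below the larger root.\<close>
    have "cmod (\<alpha> m) \<le> ?b1"
      by (rule le_larger_root) simp
    with True show ?thesis
      by linarith
  next
    case False
    obtain v where "v \<noteq> 0" "?T z *v v = 0"
      using \<open>is_eigenvalue_of ?T z\<close> by (auto simp: is_eigenvalue_of_def)
    with False show ?thesis
      by (intro le_larger_root eigenvalue_outside_poles_inequality[of m B \<alpha>])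
        (use assms(2) poles in auto)
  qed
  then have b1: "eigenvalue_modulus_bound ?T ?b1"
    by (simp add: eigenvalue_modulus_bound_def)
  have le: "?b1 \<le> ?b2"
    by (rule larger_root_le_nested_radical_bound) simp_all
  have "eigenvalue_modulus_bound ?T ?b2"
    using b1 le unfolding eigenvalue_modulus_bound_def by (meson order_trans)
  with b1 le show ?thesis
    by blast
qed

end
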